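(* Let $E$ be a compact metric space, $X=E^{\mathbb{N}}$, let $p$ be a Borel probability measure on $E$ with full support, and let $f:X\to\mathbb{R}$ be a continuous potential. Let $\nu\in\mathscr{G}^{*}(f)$ and let $\mathbb{L}_{f}:L^{1}(\nu)\to L^{1}(\nu)$ be the natural extension of the Ruelle operator $\mathscr{L}_f$. Then there exists a nonzero positive element $\xi_{f}\in L^{1}(\nu)^{**}$ such that $$\mathbb{L}_{f}^{**}\xi_{f}=\rho(\mathscr{L}_{f})\,\xi_{f}.$$
   Context: $X=E^{\mathbb{N}}$ carries the product topology (which is compact metrizable) and its Borel $\sigma$-algebra $\mathscr{B}(X)$; $C(X)$ is the Banach space of real continuous functions on $X$ with the sup norm. For $a\in E$ and $x=(x_1,x_2,\ldots)\in X$, $ax=(a,x_1,x_2,\ldots)$. The a priori measure $p$ is a fixed Borel probability measure on $E$ with $\mathrm{supp}(p)=E$. The Ruelle operator $\mathscr{L}_f:C(X)\to C(X)$ is $\mathscr{L}_{f}\varphi(x)=\int_{E}\exp(f(ax))\varphi(ax)\,dp(a)$, and $\rho(\mathscr{L}_f)$ is its spectral radius on $(C(X),\|\cdot\|_\infty)$. Let $\mathscr{M}_s(X)\cong C(X)^*$ be the space of finite signed Borel measures on $X$ and $\mathscr{M}_1(X)$ the set of Borel probability measures on $X$. The transpose $\mathscr{L}_f^*$ acts on $\mathscr{M}_s(X)$ by $\int_X\varphi\,d[\mathscr{L}_f^*\mu]=\int_X\mathscr{L}_f\varphi\,d\mu$ for all $\varphi\in C(X)$. Define $\mathscr{G}^{*}(f)=\{\nu\in\mathscr{M}_1(X):\mathscr{L}_{f}^{*}\nu=\rho(\mathscr{L}_{f})\nu\}$.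 Since $p$ has full support, every $\nu\in\mathscr{G}^*(f)$ has full support, so $C(X)$ embeds in $L^1(\nu)=L^1(X,\mathscr{B}(X),\nu)$; $\mathbb{L}_f:L^1(\nu)\to L^1(\nu)$ denotes the bounded positive linear operator extending $\mathscr{L}_f$, i.e. $\mathbb{L}_f[\varphi]_\nu=[\mathscr{L}_f\varphi]_\nu$ for all $\varphi\in C(X)$ (it exists, and is unique by density of $C(X)$). Its transpose is $\mathbb{L}_f^*:L^1(\nu)^*\to L^1(\nu)^*$, $\mathbb{L}_f^*\ell=\ell\circ\mathbb{L}_f$, and its double transpose $\mathbb{L}_f^{**}:L^1(\nu)^{**}\to L^1(\nu)^{**}$ is $(\mathbb{L}_f^{**}\xi)(\ell)=\xi(\mathbb{L}_f^*\ell)$. A functional $\ell\in L^1(\nu)^*$ is positive if $\ell(\varphi)\ge0$ for all $\varphi\ge0$ in $L^1(\nu)$; an element $\xi\in L^1(\nu)^{**}$ is positive if $\xi(\ell)\ge 0$ for every positive $\ell\in L^1(\nu)^*$. *)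

theory Defs
  imports "HOL-Probability.Probability_Measure"
begin

section \<open>The spectrum of a bounded operator on a real Banach space\<close>

text \<open>As usual for a real Banach space, the spectrum is that of the complexified operator.
  The complexification is realised on pairs, \<open>(u, v)\<close> standing for \<open>u + \<i> v\<close>; the function
  below is \<open>z I - T\<close> acting on it.  The product norm is equivalent to every complexification
  norm, so it yields the same invertible operators, and a real-linear inverse of a complex-linear
  map is complex-linear.\<close>

definition shift_minus ::
    "complex \<Rightarrow> ('a::real_normed_vector \<Rightarrow>\<^sub>L 'a) \<Rightarrow> 'a \<times> 'a \<Rightarrow> 'a \<times> 'a" where
  "shift_minus z T = (\<lambda>(u, v).
     (Re z *\<^sub>R u - Im z *\<^sub>R v - blinfun_apply T u,
      Im z *\<^sub>R u + Re z *\<^sub>R v - blinfun_apply T v))"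

definition spectrum_of :: "('a::real_normed_vector \<Rightarrow>\<^sub>L 'a) \<Rightarrow> complex set" where
  "spectrum_of T = {z. \<not> (\<exists>S :: ('a \<times> 'a) \<Rightarrow>\<^sub>L ('a \<times> 'a).
     (\<forall>w. blinfun_apply S (shift_minus z T w) = w) \<and>
     (\<forall>w. shift_minus z T (blinfun_apply S w) = w))}"

definition spectral_rad :: "('a::real_normed_vector \<Rightarrow>\<^sub>L 'a) \<Rightarrow> real" where
  "spectral_rad T = (SUP z \<in> spectrum_of T. cmod z)"


section \<open>The Ruelle operator on continuous functions\<close>

definition measure_supp :: "'a::topological_space measure \<Rightarrow> 'a set" where
  "measure_supp p = {a. \<forall>U. open U \<longrightarrow> a \<in> U \<longrightarrow> 0 < emeasure p U}"

text \<open>Points of \<open>X\<close> are sequences indexed from \<open>0\<close>, and \<open>ax\<close> is \<^term>\<open>case_nat a x\<close>.  Since \<open>X\<close> is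
  compact, \<open>C(X)\<close> is the Banach space of bounded continuous functions.  The two abstractions
  \<open>Bcontfun\<close> and \<open>Blinfun\<close> are meaningful by \<open>ruelle_apply\<close> below.\<close>

definition ruelle ::
    "'e::metric_space measure \<Rightarrow> ((nat \<Rightarrow> 'e) \<Rightarrow> real) \<Rightarrow>
     ((nat \<Rightarrow> 'e) \<Rightarrow>\<^sub>C real) \<Rightarrow>\<^sub>L ((nat \<Rightarrow> 'e) \<Rightarrow>\<^sub>C real)" where
  "ruelle p f = Blinfun (\<lambda>\<phi>. Bcontfun (\<lambda>x.
     \<integral>a. exp (f (case_nat a x)) * apply_bcontfun \<phi> (case_nat a x) \<partial>p))"

text \<open>The set \<open>\<G>*(f)\<close>.  The equation \<open>L* \<nu> = \<rho> \<nu>\<close> between finite signed Borel measures is an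
  equation in \<open>C(X)*\<close>, so it is stated by integrating all of \<open>C(X)\<close>.\<close>

definition eigenmeasures ::
    "'e::metric_space measure \<Rightarrow> ((nat \<Rightarrow> 'e) \<Rightarrow> real) \<Rightarrow> (nat \<Rightarrow> 'e) measure set" where
  "eigenmeasures p f = {\<nu>. prob_space \<nu> \<and> sets \<nu> = sets borel \<and>
     (\<forall>\<phi>. (\<integral>x. apply_bcontfun (blinfun_apply (ruelle p f) \<phi>) x \<partial>\<nu>)
        = spectral_rad (ruelle p f) * (\<integral>x. apply_bcontfun \<phi> x \<partial>\<nu>))}"


section \<open>Ordered normed spaces with explicit carrier, duals and transposes\<close>

text \<open>\<open>L\<^sup>1(\<nu>)\<close> depends on the measure \<open>\<nu>\<close>, hence is not a type; it and its duals are given by carriers.\<close>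

record 'v onspace =
  carr :: "'v set"
  add_sp :: "'v \<Rightarrow> 'v \<Rightarrow> 'v"
  zero_sp :: "'v"
  scale_sp :: "real \<Rightarrow> 'v \<Rightarrow> 'v"
  norm_sp :: "'v \<Rightarrow> real"
  pos_sp :: "'v set"

definition bounded_functional :: "'v onspace \<Rightarrow> ('v \<Rightarrow> real) \<Rightarrow> bool" where
  "bounded_functional V l \<longleftrightarrow>
     (\<forall>v\<in>carr V. \<forall>w\<in>carr V. l (add_sp V v w) = l v + l w) \<and>
     (\<forall>c. \<forall>v\<in>carr V. l (scale_sp V c v) = c * l v) \<and>
     (\<exists>C. \<forall>v\<in>carr V. \<bar>l v\<bar> \<le> C * norm_sp V v)"

text \<open>Functionals are extensional (\<open>undefined\<close> off the carrier), so that HOL equality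
  on the carrier of the dual is equality of functionals.\<close>

definition dual_carr :: "'v onspace \<Rightarrow> ('v \<Rightarrow> real) set" where
  "dual_carr V = {l \<in> extensional (carr V). bounded_functional V l}"

definition dual_sp :: "'v onspace \<Rightarrow> ('v \<Rightarrow> real) onspace" where
  "dual_sp V = \<lparr>
     carr = dual_carr V,
     add_sp = (\<lambda>l m. \<lambda>v\<in>carr V. l v + m v),
     zero_sp = (\<lambda>v\<in>carr V. 0),
     scale_sp = (\<lambda>c l. \<lambda>v\<in>carr V. c * l v),
     norm_sp = (\<lambda>l. SUP v \<in> {v \<in> carr V. norm_sp V v \<le> 1}. \<bar>l v\<bar>),
     pos_sp = {l \<in> dual_carr V. \<forall>v\<in>pos_sp V. 0 \<le> l v} \<rparr>"

definition bounded_operator :: "'v onspace \<Rightarrow> ('v \<Rightarrow> 'v) \<Rightarrow> bool" where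
  "bounded_operator V T \<longleftrightarrow>
     T \<in> carr V \<rightarrow> carr V \<and>
     (\<forall>v\<in>carr V. \<forall>w\<in>carr V. T (add_sp V v w) = add_sp V (T v) (T w)) \<and>
     (\<forall>c. \<forall>v\<in>carr V. T (scale_sp V c v) = scale_sp V c (T v)) \<and>
     (\<exists>C. \<forall>v\<in>carr V. norm_sp V (T v) \<le> C * norm_sp V v)"

definition positive_operator :: "'v onspace \<Rightarrow> ('v \<Rightarrow> 'v) \<Rightarrow> bool" where
  "positive_operator V T \<longleftrightarrow> T \<in> pos_sp V \<rightarrow> pos_sp V"

definition transpose_op ::
    "'v onspace \<Rightarrow> ('v \<Rightarrow> 'v) \<Rightarrow> ('v \<Rightarrow> real) \<Rightarrow> ('v \<Rightarrow> real)" where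
  "transpose_op V T = (\<lambda>l\<in>carr (dual_sp V). \<lambda>v\<in>carr V. l (T v))"


section \<open>The space of integrable functions modulo null sets\<close>

definition L1_class :: "'x measure \<Rightarrow> ('x \<Rightarrow> real) \<Rightarrow> ('x \<Rightarrow> real) set" where
  "L1_class \<nu> \<phi> = {\<psi>. integrable \<nu> \<psi> \<and> (AE x in \<nu>. \<phi> x = \<psi> x)}"

definition L1_rep :: "('x \<Rightarrow> real) set \<Rightarrow> 'x \<Rightarrow> real" where
  "L1_rep u = (SOME \<phi>. \<phi> \<in> u)"

text \<open>The operations are independent of the chosen representatives; see the lemmas below.\<close>

definition L1_sp :: "'x measure \<Rightarrow> ('x \<Rightarrow> real) set onspace" where
  "L1_sp \<nu> = \<lparr>
     carr = L1_class \<nu> ` {\<phi>. integrable \<nu> \<phi>},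
     add_sp = (\<lambda>u w. L1_class \<nu> (\<lambda>x. L1_rep u x + L1_rep w x)),
     zero_sp = L1_class \<nu> (\<lambda>x. 0),
     scale_sp = (\<lambda>c u. L1_class \<nu> (\<lambda>x. c * L1_rep u x)),
     norm_sp = (\<lambda>u. \<integral>x. \<bar>L1_rep u x\<bar> \<partial>\<nu>),
     pos_sp = L1_class \<nu> ` {\<phi>. integrable \<nu> \<phi> \<and> (AE x in \<nu>. 0 \<le> \<phi> x)} \<rparr>"

definition L1_extension ::
    "'e::metric_space measure \<Rightarrow> ((nat \<Rightarrow> 'e) \<Rightarrow> real) \<Rightarrow> (nat \<Rightarrow> 'e) measure \<Rightarrow>
     (((nat \<Rightarrow> 'e) \<Rightarrow> real) set \<Rightarrow> ((nat \<Rightarrow> 'e) \<Rightarrow> real) set) \<Rightarrow> bool" where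
  "L1_extension p f \<nu> T \<longleftrightarrow>
     bounded_operator (L1_sp \<nu>) T \<and> positive_operator (L1_sp \<nu>) T \<and>
     (\<forall>\<phi>. T (L1_class \<nu> (apply_bcontfun \<phi>))
        = L1_class \<nu> (apply_bcontfun (blinfun_apply (ruelle p f) \<phi>)))"


section \<open>Well-definedness\<close>

lemma L1_class_eq:
  assumes "integrable \<nu> \<phi>" "integrable \<nu> \<psi>"
  shows "L1_class \<nu> \<phi> = L1_class \<nu> \<psi> \<longleftrightarrow> (AE x in \<nu>. \<phi> x = \<psi> x)"
proof
  assume "L1_class \<nu> \<phi> = L1_class \<nu> \<psi>"
  moreover have "\<psi> \<in> L1_class \<nu> \<psi>" using assms by (simp add: L1_class_def)
  ultimately have "\<psi> \<in> L1_class \<nu> \<phi>" by simp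
  then show "AE x in \<nu>. \<phi> x = \<psi> x" by (simp add: L1_class_def)
next
  assume ae: "AE x in \<nu>. \<phi> x = \<psi> x"
  have "(AE x in \<nu>. \<phi> x = h x) \<longleftrightarrow> (AE x in \<nu>. \<psi> x = h x)" for h
    using ae by (auto elim: eventually_elim2)
  then show "L1_class \<nu> \<phi> = L1_class \<nu> \<psi>" by (simp add: L1_class_def)
qed

lemma L1_rep_class:
  assumes "integrable \<nu> \<phi>"
  shows "integrable \<nu> (L1_rep (L1_class \<nu> \<phi>))" "AE x in \<nu>. \<phi> x = L1_rep (L1_class \<nu> \<phi>) x"
proof -
  have "\<phi> \<in> L1_class \<nu> \<phi>" using assms by (simp add: L1_class_def)
  then have "L1_rep (L1_class \<nu> \<phi>) \<in> L1_class \<nu> \<phi>"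
    unfolding L1_rep_def by (rule someI[where P = "\<lambda>h. h \<in> L1_class \<nu> \<phi>"])
  then show "integrable \<nu> (L1_rep (L1_class \<nu> \<phi>))" "AE x in \<nu>. \<phi> x = L1_rep (L1_class \<nu> \<phi>) x"
    by (auto simp: L1_class_def)
qed

lemma L1_add:
  assumes "integrable \<nu> \<phi>" "integrable \<nu> \<psi>"
  shows "add_sp (L1_sp \<nu>) (L1_class \<nu> \<phi>) (L1_class \<nu> \<psi>) = L1_class \<nu> (\<lambda>x. \<phi> x + \<psi> x)"
proof -
  have "AE x in \<nu>. L1_rep (L1_class \<nu> \<phi>) x + L1_rep (L1_class \<nu> \<psi>) x = \<phi> x + \<psi> x"
    using L1_rep_class(2)[OF assms(1)] L1_rep_class(2)[OF assms(2)] by eventually_elim simp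
  then have "L1_class \<nu> (\<lambda>x. L1_rep (L1_class \<nu> \<phi>) x + L1_rep (L1_class \<nu> \<psi>) x) = L1_class \<nu> (\<lambda>x. \<phi> x + \<psi> x)"
    using assms L1_rep_class(1)[OF assms(1)] L1_rep_class(1)[OF assms(2)] by (subst L1_class_eq) auto
  then show ?thesis by (simp add: L1_sp_def)
qed

lemma L1_scale:
  assumes "integrable \<nu> \<phi>"
  shows "scale_sp (L1_sp \<nu>) c (L1_class \<nu> \<phi>) = L1_class \<nu> (\<lambda>x. c * \<phi> x)"
proof -
  have "AE x in \<nu>. c * L1_rep (L1_class \<nu> \<phi>) x = c * \<phi> x"
    using L1_rep_class(2)[OF assms(1)] by eventually_elim simp
  then have "L1_class \<nu> (\<lambda>x. c * L1_rep (L1_class \<nu> \<phi>) x) = L1_class \<nu> (\<lambda>x. c * \<phi> x)"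
    using assms L1_rep_class(1)[OF assms(1)] by (subst L1_class_eq) auto
  then show ?thesis by (simp add: L1_sp_def)
qed

lemma L1_norm:
  assumes "integrable \<nu> \<phi>"
  shows "norm_sp (L1_sp \<nu>) (L1_class \<nu> \<phi>) = (\<integral>x. \<bar>\<phi> x\<bar> \<partial>\<nu>)"
proof -
  have "AE x in \<nu>. \<bar>L1_rep (L1_class \<nu> \<phi>) x\<bar> = \<bar>\<phi> x\<bar>"
    using L1_rep_class(2)[OF assms(1)] by eventually_elim simp
  then show ?thesis
    using assms L1_rep_class(1)[OF assms]
    by (simp add: L1_sp_def) (intro integral_cong_AE; auto)
qed

lemma compact_sequences:
  assumes "compact (UNIV :: 'e::metric_space set)"
  shows "compact (UNIV :: (nat \<Rightarrow> 'e) set)"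
proof -
  have "compact_space (product_topology (\<lambda>_::nat. euclidean :: 'e topology) UNIV)"
    using assms unfolding compact_space_product_topology by (simp add: compact_space_def)
  then show ?thesis
    by (simp add: euclidean_product_topology compact_space_def)
qed

lemma continuous_case_nat:
  "continuous_on UNIV (\<lambda>(a, x). case_nat a x :: nat \<Rightarrow> 'e::metric_space)"
proof (rule continuous_on_coordinatewise_then_product)
  fix i :: nat
  have "continuous_on UNIV (\<lambda>(y :: 'e \<times> (nat \<Rightarrow> 'e)). snd y k)" for k
    by (rule continuous_on_product_then_coordinatewise) (intro continuous_intros)
  then show "continuous_on UNIV (\<lambda>y. (\<lambda>(a, x). case_nat a x :: nat \<Rightarrow> 'e) y i)"
    by (cases i) (auto simp: case_prod_unfold intro: continuous_intros)
qed

lemma ruelle_integrand: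
  fixes p :: "'e::metric_space measure" and g :: "(nat \<Rightarrow> 'e) \<Rightarrow> real"
  assumes K: "compact (UNIV :: 'e set)" and p: "prob_space p" "sets p = sets borel"
    and g: "continuous_on UNIV g"
  shows "integrable p (\<lambda>a. g (case_nat a x))"
    and "(\<lambda>x. \<integral>a. g (case_nat a x) \<partial>p) \<in> bcontfun"
    and "(\<And>y. \<bar>g y\<bar> \<le> B) \<Longrightarrow> \<bar>\<integral>a. g (case_nat a x) \<partial>p\<bar> \<le> B"
proof -
  interpret prob_space p by fact
  have gc: "continuous_on UNIV (\<lambda>(a, x). g (case_nat a x))"
    using continuous_on_compose2[OF g continuous_case_nat] by (simp add: case_prod_unfold)
  have gca: "continuous_on UNIV (\<lambda>a. g (case_nat a x))" for x
    using continuous_on_compose2[OF gc, of UNIV "\<lambda>a. (a, x)"] by (simp add: continuous_intros)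
  have gcx: "continuous_on UNIV (\<lambda>x. g (case_nat a x))" for a
    using continuous_on_compose2[OF gc, of UNIV "\<lambda>x. (a, x)"] by (simp add: continuous_intros)
  have meas: "(\<lambda>a. g (case_nat a x)) \<in> borel_measurable p" for x
    using borel_measurable_continuous_onI[OF gca] p(2) measurable_cong_sets by blast
  have intg: "integrable p (\<lambda>a. g (case_nat a x))" if "\<And>y. \<bar>g y\<bar> \<le> B" for B x
    using that by (intro integrable_const_bound[of _ B] meas) auto
  have bound: "\<bar>\<integral>a. g (case_nat a x) \<partial>p\<bar> \<le> B" if B: "\<And>y. \<bar>g y\<bar> \<le> B" for B x
  proof -
    have "\<bar>\<integral>a. g (case_nat a x) \<partial>p\<bar> \<le> (\<integral>a. \<bar>g (case_nat a x)\<bar> \<partial>p)"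
      by (rule integral_abs_bound)
    also have "\<dots> \<le> (\<integral>a. B \<partial>p)"
      using intg[OF B] B by (intro integral_mono) auto
    finally show ?thesis by (simp add: prob_space)
  qed
  have "compact (range g)"
    using compact_continuous_image[OF g compact_sequences[OF K]] .
  then obtain B where B: "\<And>y. \<bar>g y\<bar> \<le> B"
    using compact_imp_bounded[of "range g"] by (fastforce simp: bounded_iff)
  have "continuous_on UNIV (\<lambda>x. \<integral>a. g (case_nat a x) \<partial>p)"
    unfolding continuous_on_sequentially o_def
  proof (intro allI ballI impI)
    show "((\<lambda>n. \<integral>a. g (case_nat a (u n)) \<partial>p) \<longlonglongrightarrow> (\<integral>a. g (case_nat a l) \<partial>p))"
      if "(\<forall>n. u n \<in> UNIV) \<and> u \<longlonglongrightarrow> l" for u :: "nat \<Rightarrow> nat \<Rightarrow> 'e" and l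
    proof (rule integral_dominated_convergence[where w = "\<lambda>_. B"])
      have "(\<lambda>n. g (case_nat a (u n))) \<longlonglongrightarrow> g (case_nat a l)" for a
        using gcx[of a] that by (auto simp: continuous_on_sequentially o_def)
      then show "AE a in p. (\<lambda>n. g (case_nat a (u n))) \<longlonglongrightarrow> g (case_nat a l)" by simp
    qed (use B meas in auto)
  qed
  then show "(\<lambda>x. \<integral>a. g (case_nat a x) \<partial>p) \<in> bcontfun"
    using bound[OF B] by (auto simp: bcontfun_def bounded_iff)
  show "integrable p (\<lambda>a. g (case_nat a x))" using intg[OF B] .
  show "(\<And>y. \<bar>g y\<bar> \<le> B) \<Longrightarrow> \<bar>\<integral>a. g (case_nat a x) \<partial>p\<bar> \<le> B" for B by (rule bound)
qed

lemma ruelle_apply: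
  fixes p :: "'e::metric_space measure" and f :: "(nat \<Rightarrow> 'e) \<Rightarrow> real"
  assumes K: "compact (UNIV :: 'e set)" and p: "prob_space p" "sets p = sets borel"
    and f: "continuous_on UNIV f"
  shows "apply_bcontfun (blinfun_apply (ruelle p f) \<phi>) x =
    (\<integral>a. exp (f (case_nat a x)) * apply_bcontfun \<phi> (case_nat a x) \<partial>p)"
proof -
  let ?g = "\<lambda>\<phi> y. exp (f y) * apply_bcontfun \<phi> y"
  let ?L = "\<lambda>\<phi>. Bcontfun (\<lambda>x. \<integral>a. ?g \<phi> (case_nat a x) \<partial>p)"
  have g: "continuous_on UNIV (?g \<phi>)" for \<phi>
    by (intro continuous_intros f continuous_on_apply_bcontfun)
  note integrand = ruelle_integrand[OF K p g]
  have L: "apply_bcontfun (?L \<phi>) x = (\<integral>a. ?g \<phi> (case_nat a x) \<partial>p)" for \<phi> x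
    using integrand(2) by (simp add: Bcontfun_inverse)
  have "compact (range (\<lambda>y. exp (f y)))"
    by (intro compact_continuous_image compact_sequences K continuous_intros f)
  then obtain B where B: "\<And>y. exp (f y) \<le> B"
    using compact_imp_bounded[of "range (\<lambda>y. exp (f y))"] by (fastforce simp: bounded_iff)
  have "bounded_linear ?L"
  proof (rule bounded_linear_intro)
    show "?L (\<phi> + \<psi>) = ?L \<phi> + ?L \<psi>" for \<phi> \<psi>
    proof (rule bcontfun_eqI)
      fix x
      have "(\<integral>a. ?g (\<phi> + \<psi>) (case_nat a x) \<partial>p)
          = (\<integral>a. ?g \<phi> (case_nat a x) \<partial>p) + (\<integral>a. ?g \<psi> (case_nat a x) \<partial>p)"
        using integrand(1) by (simp add: distrib_left)
      then show "apply_bcontfun (?L (\<phi> + \<psi>)) x = apply_bcontfun (?L \<phi> + ?L \<psi>) x"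
        by (simp only: L plus_bcontfun.rep_eq[of "?L \<phi>" "?L \<psi>"])
    qed
    show "?L (r *\<^sub>R \<phi>) = r *\<^sub>R ?L \<phi>" for r \<phi>
    proof (rule bcontfun_eqI)
      fix x
      have "(\<integral>a. ?g (r *\<^sub>R \<phi>) (case_nat a x) \<partial>p) = r * (\<integral>a. ?g \<phi> (case_nat a x) \<partial>p)"
        by (simp add: mult.left_commute)
      then show "apply_bcontfun (?L (r *\<^sub>R \<phi>)) x = apply_bcontfun (r *\<^sub>R ?L \<phi>) x"
        by (simp only: L scaleR_bcontfun.rep_eq[of r "?L \<phi>"] real_scaleR_def)
    qed
    show "norm (?L \<phi>) \<le> norm \<phi> * B" for \<phi>
    proof (rule norm_bound)
      have "\<bar>?g \<phi> y\<bar> \<le> norm \<phi> * B" for y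
        using mult_mono[OF norm_bounded[of \<phi> y] B[of y]] by (simp add: abs_mult mult.commute)
      from integrand(3)[OF this]
      show "norm (apply_bcontfun (?L \<phi>) x) \<le> norm \<phi> * B" for x by (simp add: L)
    qed
  qed
  then show ?thesis
    by (simp add: ruelle_def bounded_linear_Blinfun_apply L)
qed

end

theory Submission
  imports Defs
begin

text \<open>The functions \<open>\<rho>\<^sup>-\<^sup>n L\<^sup>n 1\<close> are nonnegative and have integral one under the eigenmeasure, so
  their classes form a bounded sequence \<open>w n\<close> of positive elements of \<open>L\<^sup>1(\<nu>)\<close> with
  \<open>T (w n) = \<rho> w (n + 1)\<close>.  By Tychonoff, the Cesaro means of the evaluations at \<open>w n\<close> have a
  weak-star cluster point \<open>\<xi>\<close> in the bidual; telescoping makes it an eigenvector, and its value at the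
  integral functional is one.\<close>

section \<open>Tychonoff compactness along a filter on the indices\<close>

text \<open>The sequence lives in a product of compact closures, which is compact by Tychonoff. The
  result is a proper filter \<open>G\<close> finer than \<open>sequentially\<close> rather than a
  subsequence: \<open>S\<close> may be uncountable, and the product need not be sequentially
  compact.\<close>

lemma bounded_pointwise_cluster:
  fixes a :: "nat \<Rightarrow> 's \<Rightarrow> real"
  assumes bd: "\<And>s. s \<in> S \<Longrightarrow> bounded (range (\<lambda>n. a n s))"
  obtains \<xi> G where "G \<noteq> bot" "G \<le> sequentially" "\<And>s. s \<in> S \<Longrightarrow> ((\<lambda>n. a n s) \<longlongrightarrow> \<xi> s) G"
proof -
  \<comment> \<open>Boundedness is known only on \<open>S\<close>; the value 0 elsewhere lets the
    product range over the whole type.\<close>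
  define b where "b n s = (if s \<in> S then a n s else 0)" for n s
  have "bounded (range (\<lambda>n. b n s))" for s
    using bd by (cases "s \<in> S") (auto simp: b_def)
  define K where "K = PiE UNIV (\<lambda>s. closure (range (\<lambda>n. b n s)))"
  have "compactin (product_topology (\<lambda>_. euclidean) UNIV) K"
    unfolding K_def compactin_PiE
    using \<open>\<And>s. bounded (range (\<lambda>n. b n s))\<close> by (simp add: compact_closure)
  then have "compact K"
    by (simp add: euclidean_product_topology)
  moreover have "\<forall>\<^sub>F h in filtermap b sequentially. h \<in> K"
    by (auto simp: eventually_filtermap K_def intro!: always_eventually closure_subset[THEN subsetD])
  moreover have "filtermap b sequentially \<noteq> bot"
    by (simp add: filtermap_bot_iff)
  ultimately obtain \<xi> where \<xi>: "inf (nhds \<xi>) (filtermap b sequentially) \<noteq> bot"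
    unfolding compact_filter by blast
  \<comment> \<open>The cluster point is turned into convergence on the index side: \<open>G\<close>
    consists of the late indices at which \<open>b\<close> is near \<open>\<xi>\<close>.\<close>
  define G where "G = inf (filtercomap b (nhds \<xi>)) sequentially"
  have "G \<noteq> bot"
  proof
    assume "G = bot"
    \<comment> \<open>If \<open>G\<close> were trivial, some neighbourhood \<open>R\<close> of
      \<open>\<xi>\<close> would be left by \<open>b n\<close> for all large \<open>n\<close>, so
      \<open>\<xi>\<close> would not be a cluster point.\<close>
    then obtain P Q where P: "\<forall>\<^sub>F n in filtercomap b (nhds \<xi>). P n"
      and Q: "\<forall>\<^sub>F n in sequentially. Q n" and "\<And>n. P n \<Longrightarrow> Q n \<Longrightarrow> False"
      unfolding G_def trivial_limit_def eventually_inf by blast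
    then have PQ: "\<And>n. P n \<Longrightarrow> \<not> Q n" by blast
    obtain R where R: "\<forall>\<^sub>F h in nhds \<xi>. R h" "\<And>n. R (b n) \<Longrightarrow> P n"
      using P unfolding eventually_filtercomap by blast
    have "\<forall>\<^sub>F h in filtermap b sequentially. \<not> R h"
      unfolding eventually_filtermap using Q by (rule eventually_mono) (use R PQ in blast)
    then have "inf (nhds \<xi>) (filtermap b sequentially) = bot"
      using R(1) unfolding trivial_limit_def eventually_inf by blast
    with \<xi> show False ..
  qed
  moreover have "G \<le> sequentially" by (simp add: G_def)
  moreover have "((\<lambda>n. a n s) \<longlongrightarrow> \<xi> s) G" if "s \<in> S" for s
  proof -
    have "filterlim b (nhds \<xi>) G"
      unfolding G_def by (intro filterlim_mono[OF filterlim_filtercomap]) auto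
    then have "((\<lambda>n. b n s) \<longlongrightarrow> \<xi> s) G"
      using continuous_on_tendsto_compose[OF continuous_on_product_coordinates[of s]] by simp
    then show ?thesis using that by (simp add: b_def)
  qed
  ultimately show thesis by (rule that)
qed

section \<open>Eigenvectors in the bidual of a space given by its carrier\<close>

lemma dual_carr_bound:
  assumes "l \<in> dual_carr V"
  obtains C where "\<And>v. v \<in> carr V \<Longrightarrow> \<bar>l v\<bar> \<le> C * norm_sp V v"
proof -
  have "\<exists>C. \<forall>v\<in>carr V. \<bar>l v\<bar> \<le> C * norm_sp V v"
    using assms by (simp add: dual_carr_def bounded_functional_def)
  then show thesis using that by blast
qed

text \<open>The bounds of \<open>l\<close> and \<open>T\<close> multiply. The record
  \<open>V\<close> carries no vector space axioms, so closure of the carrier is assumed; it allows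
  the restricted function to be evaluated at sums and multiples.\<close>

lemma transpose_in_dual:
  assumes T: "bounded_operator V T" and nn: "\<And>v. v \<in> carr V \<Longrightarrow> 0 \<le> norm_sp V v"
    and add: "\<And>v w. v \<in> carr V \<Longrightarrow> w \<in> carr V \<Longrightarrow> add_sp V v w \<in> carr V"
    and scale: "\<And>c v. v \<in> carr V \<Longrightarrow> scale_sp V c v \<in> carr V"
    and l: "l \<in> dual_carr V"
  shows "transpose_op V T l \<in> dual_carr V"
proof -
  have TV: "\<And>v. v \<in> carr V \<Longrightarrow> T v \<in> carr V"
    using T by (auto simp: bounded_operator_def)
  obtain C where C: "\<And>v. v \<in> carr V \<Longrightarrow> \<bar>l v\<bar> \<le> C * norm_sp V v"
    using dual_carr_bound[of l V] l by blast
  obtain D where D: "\<And>v. v \<in> carr V \<Longrightarrow> norm_sp V (T v) \<le> D * norm_sp V v"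
    using T unfolding bounded_operator_def by blast
  have "\<bar>l (T v)\<bar> \<le> (\<bar>C\<bar> * D) * norm_sp V v" if "v \<in> carr V" for v
  proof -
    have "\<bar>l (T v)\<bar> \<le> C * norm_sp V (T v)" using C TV that by blast
    \<comment> \<open>The constant \<open>C\<close> may be negative, hence the passage to
      \<open>\<bar>C\<bar>\<close> before multiplying inequalities.\<close>
    also have "\<dots> \<le> \<bar>C\<bar> * norm_sp V (T v)" using nn TV that by (intro mult_right_mono) auto
    also have "\<dots> \<le> \<bar>C\<bar> * (D * norm_sp V v)" using D that by (intro mult_left_mono) auto
    finally show ?thesis by (simp add: mult.assoc)
  qed
  then have bd: "\<exists>C. \<forall>v\<in>carr V. \<bar>l (T v)\<bar> \<le> C * norm_sp V v" by blast
  have eq: "transpose_op V T l = (\<lambda>v\<in>carr V. l (T v))"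
    using l by (simp add: transpose_op_def dual_sp_def)
  show ?thesis
    unfolding eq using l T bd TV add scale
    by (simp add: dual_carr_def bounded_functional_def bounded_operator_def)
qed

text \<open>On the sequence \<open>w\<close> the operator is \<open>\<rho>\<close> times a shift,
  and Cesaro means of a bounded sequence are invariant under shifts up to a boundary term of order
  1/N. The functional \<open>l0\<close> keeps the limit away from zero.\<close>

theorem bidual_eigenvector:
  assumes T: "bounded_operator V T" and nn: "\<And>v. v \<in> carr V \<Longrightarrow> 0 \<le> norm_sp V v"
    and add: "\<And>v w. v \<in> carr V \<Longrightarrow> w \<in> carr V \<Longrightarrow> add_sp V v w \<in> carr V"
    and scale: "\<And>c v. v \<in> carr V \<Longrightarrow> scale_sp V c v \<in> carr V"
    and w: "\<And>n. w n \<in> carr V" "\<And>n. w n \<in> pos_sp V" "\<And>n. norm_sp V (w n) \<le> 1"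
    and Tw: "\<And>n. T (w n) = scale_sp V \<rho> (w (Suc n))"
    and l0: "l0 \<in> dual_carr V" "\<And>n. l0 (w n) = 1"
  shows "\<exists>\<xi> \<in> carr (dual_sp (dual_sp V)). \<xi> \<noteq> zero_sp (dual_sp (dual_sp V)) \<and>
    \<xi> \<in> pos_sp (dual_sp (dual_sp V)) \<and>
    transpose_op (dual_sp V) (transpose_op V T) \<xi> = scale_sp (dual_sp (dual_sp V)) \<rho> \<xi>"
proof -
  have carr: "carr (dual_sp V) = dual_carr V" for V :: "'v onspace" by (simp add: dual_sp_def)
  \<comment> \<open>The dual norm is a real supremum, so it bounds the values of \<open>l\<close>
    only once the set is known to be bounded above; the constant \<open>C\<close> provides
    this.\<close>
  have lw: "\<bar>l (w n)\<bar> \<le> norm_sp (dual_sp V) l" if l: "l \<in> dual_carr V" for l n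
  proof -
    obtain C where C: "\<And>v. v \<in> carr V \<Longrightarrow> \<bar>l v\<bar> \<le> C * norm_sp V v"
      using dual_carr_bound[of l V] l by blast
    have "\<bar>l v\<bar> \<le> \<bar>C\<bar>" if "v \<in> carr V" "norm_sp V v \<le> 1" for v
    proof -
      have "\<bar>l v\<bar> \<le> C * norm_sp V v" using C that by blast
      also have "\<dots> \<le> \<bar>C\<bar> * norm_sp V v" using nn that by (intro mult_right_mono) auto
      also have "\<dots> \<le> \<bar>C\<bar> * 1" using that by (intro mult_left_mono) auto
      finally show ?thesis by simp
    qed
    then have "bdd_above ((\<lambda>v. \<bar>l v\<bar>) ` {v \<in> carr V. norm_sp V v \<le> 1})"
      by (intro bdd_aboveI[of _ "\<bar>C\<bar>"]) auto
    then show ?thesis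
      unfolding dual_sp_def onspace.simps by (rule cSUP_upper[rotated]) (use w in auto)
  qed
  \<comment> \<open>For positive \<open>N\<close> this evaluates \<open>l\<close> at the mean of the
    first \<open>N\<close> terms of \<open>w\<close>. For \<open>N = 0\<close> it is 0 by the
    convention on division, and the bound below has to cover that case too.\<close>
  define a where "a N l = (\<Sum>n<N. l (w n)) / real N" for N l
  have a_le: "\<bar>a N l\<bar> \<le> norm_sp (dual_sp V) l" if l: "l \<in> dual_carr V" for N l
  proof (cases "N = 0")
    case True
    then show ?thesis using lw[OF l, of 0] by (simp add: a_def)
  next
    case False
    have "\<bar>\<Sum>n<N. l (w n)\<bar> \<le> (\<Sum>n<N. norm_sp (dual_sp V) l)"
      by (rule order_trans[OF sum_abs]) (intro sum_mono lw l)
    then show ?thesis using False by (simp add: a_def field_simps)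
  qed
  have "bounded (range (\<lambda>N. a N l))" if "l \<in> dual_carr V" for l
    using a_le[OF that] by (auto simp: bounded_iff)
  then obtain \<xi>0 G where G: "G \<noteq> bot" "G \<le> sequentially"
    and lim: "\<And>l. l \<in> dual_carr V \<Longrightarrow> ((\<lambda>N. a N l) \<longlongrightarrow> \<xi>0 l) G"
    using bounded_pointwise_cluster[of "dual_carr V" a] by blast
  have add_dual: "add_sp (dual_sp V) l m \<in> dual_carr V" if lm: "l \<in> dual_carr V" "m \<in> dual_carr V" for l m
  proof -
    obtain C where C: "\<And>v. v \<in> carr V \<Longrightarrow> \<bar>l v\<bar> \<le> C * norm_sp V v"
      using dual_carr_bound[of l V] lm by blast
    obtain D where D: "\<And>v. v \<in> carr V \<Longrightarrow> \<bar>m v\<bar> \<le> D * norm_sp V v"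
      using dual_carr_bound[of m V] lm by blast
    have "\<bar>l v + m v\<bar> \<le> (C + D) * norm_sp V v" if "v \<in> carr V" for v
      using C[OF that] D[OF that] by (simp add: distrib_right)
    then have "\<exists>C. \<forall>v\<in>carr V. \<bar>l v + m v\<bar> \<le> C * norm_sp V v" by blast
    then show ?thesis
      using lm add scale by (simp add: dual_sp_def dual_carr_def bounded_functional_def algebra_simps)
  qed
  have scale_dual: "scale_sp (dual_sp V) c l \<in> dual_carr V" if l: "l \<in> dual_carr V" for c l
  proof -
    obtain C where C: "\<And>v. v \<in> carr V \<Longrightarrow> \<bar>l v\<bar> \<le> C * norm_sp V v"
      using dual_carr_bound[of l V] l by blast
    have "\<bar>c * l v\<bar> \<le> (\<bar>c\<bar> * C) * norm_sp V v" if "v \<in> carr V" for v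
      using mult_left_mono[OF C[OF that], of "\<bar>c\<bar>"] by (simp add: abs_mult mult.assoc)
    then have "\<exists>C. \<forall>v\<in>carr V. \<bar>c * l v\<bar> \<le> C * norm_sp V v" by blast
    then show ?thesis
      using l add scale by (simp add: dual_sp_def dual_carr_def bounded_functional_def algebra_simps)
  qed
  \<comment> \<open>The limit is restricted to the dual because elements of the bidual are
    extensional.\<close>
  define \<xi> where "\<xi> = (\<lambda>l\<in>dual_carr V. \<xi>0 l)"
  \<comment> \<open>Limits along the proper filter \<open>G\<close> are unique; linearity, the value
    at \<open>l0\<close> and the eigenvalue equation are all obtained this way.\<close>
  have \<xi>_eq: "\<xi> l = x" if "l \<in> dual_carr V" "((\<lambda>N. a N l) \<longlongrightarrow> x) G" for l x
    using tendsto_unique[OF G(1) lim that(2)] that by (simp add: \<xi>_def)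
  have lim: "((\<lambda>N. a N l) \<longlongrightarrow> \<xi> l) G" if "l \<in> dual_carr V" for l
    using lim that by (simp add: \<xi>_def)
  have \<xi>_add: "\<xi> (add_sp (dual_sp V) l m) = \<xi> l + \<xi> m" if "l \<in> dual_carr V" "m \<in> dual_carr V" for l m
  proof (rule \<xi>_eq)
    have "a N (add_sp (dual_sp V) l m) = a N l + a N m" for N
      using w by (simp add: a_def dual_sp_def sum.distrib add_divide_distrib)
    then show "((\<lambda>N. a N (add_sp (dual_sp V) l m)) \<longlongrightarrow> \<xi> l + \<xi> m) G"
      using tendsto_add[OF lim lim] that by simp
  qed (use add_dual that in auto)
  have \<xi>_scale: "\<xi> (scale_sp (dual_sp V) c l) = c * \<xi> l" if "l \<in> dual_carr V" for c l
  proof (rule \<xi>_eq)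
    have "a N (scale_sp (dual_sp V) c l) = c * a N l" for N
      using w by (simp add: a_def dual_sp_def sum_distrib_left)
    then show "((\<lambda>N. a N (scale_sp (dual_sp V) c l)) \<longlongrightarrow> c * \<xi> l) G"
      using tendsto_mult_left[OF lim] that by simp
  qed (use scale_dual that in auto)
  have \<xi>_bd: "\<bar>\<xi> l\<bar> \<le> 1 * norm_sp (dual_sp V) l" if "l \<in> dual_carr V" for l
    using tendsto_upperbound[OF tendsto_rabs[OF lim[OF that]] _ G(1)] a_le[OF that] by simp
  have \<xi>_ext: "\<xi> \<in> extensional (dual_carr V)"
    by (simp add: \<xi>_def)
  have \<xi>_dual: "\<xi> \<in> dual_carr (dual_sp V)"
    unfolding dual_carr_def[of "dual_sp V"] bounded_functional_def carr
    using \<xi>_add \<xi>_scale \<xi>_bd by (blast intro: \<xi>_ext)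
  have "\<xi> l0 = 1"
  proof (rule \<xi>_eq)
    \<comment> \<open>The mean is 1 for every positive \<open>N\<close> but 0 for
      \<open>N = 0\<close>, so it is only eventually constant.\<close>
    have "\<forall>\<^sub>F N in sequentially. a N l0 = 1"
      using eventually_gt_at_top[of 0] by eventually_elim (simp add: a_def l0)
    then show "((\<lambda>N. a N l0) \<longlongrightarrow> 1) G"
      by (intro tendsto_mono[OF G(2)] tendsto_eventually)
  qed (fact l0)
  then have nz: "\<xi> \<noteq> zero_sp (dual_sp (dual_sp V))"
    using l0 by (auto simp: dual_sp_def[of "dual_sp V"] carr)
  have "0 \<le> \<xi> l" if "l \<in> pos_sp (dual_sp V)" for l
  proof -
    have l: "l \<in> dual_carr V" "\<And>v. v \<in> pos_sp V \<Longrightarrow> 0 \<le> l v"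
      using that by (auto simp: dual_sp_def)
    then have "0 \<le> a N l" for N
      using w by (auto simp: a_def intro!: divide_nonneg_nonneg sum_nonneg)
    then show ?thesis
      using tendsto_lowerbound[OF lim[OF l(1)] _ G(1)] by simp
  qed
  then have pos: "\<xi> \<in> pos_sp (dual_sp (dual_sp V))"
    using \<xi>_dual by (simp add: dual_sp_def[of "dual_sp V"])
  have eig: "\<xi> (transpose_op V T l) = \<rho> * \<xi> l" if l: "l \<in> dual_carr V" for l
  proof (rule \<xi>_eq)
    show "transpose_op V T l \<in> dual_carr V"
      by (rule transpose_in_dual[OF T nn add scale l])
    have "transpose_op V T l (w n) = \<rho> * l (w (Suc n))" for n
      using l w by (simp add: transpose_op_def carr Tw dual_carr_def bounded_functional_def)
    \<comment> \<open>Telescoping: the shifted sum differs from the original by its two end terms,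
      which stay bounded by the dual norm and vanish after division by \<open>N\<close>.\<close>
    moreover have "(\<Sum>n<N. l (w (Suc n))) = (\<Sum>n<N. l (w n)) + (l (w N) - l (w 0))" for N
      by (induction N) auto
    ultimately have aT: "a N (transpose_op V T l) = \<rho> * a N l + \<rho> * ((l (w N) - l (w 0)) / real N)" for N
      by (simp add: a_def flip: sum_distrib_left) (simp add: algebra_simps add_divide_distrib diff_divide_distrib)
    have "\<bar>l (w N) - l (w 0)\<bar> \<le> 2 * norm_sp (dual_sp V) l" for N
      using lw[OF l, of N] lw[OF l, of 0] by linarith
    then have "norm ((l (w N) - l (w 0)) / real N) \<le> 2 * norm_sp (dual_sp V) l / real N" for N
      by (simp add: divide_right_mono)
    then have "(\<lambda>N. (l (w N) - l (w 0)) / real N) \<longlonglongrightarrow> 0"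
      by (intro Lim_null_comparison[OF always_eventually lim_const_over_n]) blast
    then have tel: "((\<lambda>N. (l (w N) - l (w 0)) / real N) \<longlongrightarrow> 0) G"
      by (rule tendsto_mono[OF G(2)])
    then show "((\<lambda>N. a N (transpose_op V T l)) \<longlongrightarrow> \<rho> * \<xi> l) G"
      using tendsto_add[OF tendsto_mult_left[OF lim[OF l], of \<rho>] tendsto_mult_left[OF tel, of \<rho>]]
      by (simp only: aT mult_zero_right add_0_right)
  qed
  \<comment> \<open>Both sides are restricted to the dual, so \<open>eig\<close> on that carrier
    gives equality of functions.\<close>
  have "transpose_op (dual_sp V) (transpose_op V T) \<xi> = scale_sp (dual_sp (dual_sp V)) \<rho> \<xi>"
    using \<xi>_dual eig by (auto simp: transpose_op_def[of "dual_sp V"] dual_sp_def[of "dual_sp V"] carr)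
  moreover have "\<xi> \<in> carr (dual_sp (dual_sp V))"
    using \<xi>_dual by (simp add: dual_sp_def[of "dual_sp V"])
  ultimately show ?thesis using nz pos by blast
qed

section \<open>Normalised Ruelle iterates in \<open>L1_sp \<nu>\<close>\<close>

text \<open>Linearity and the bound with constant 1 are inherited from the Bochner integral, whose
  value does not depend on the representative. This functional serves as \<open>l0\<close>.\<close>

lemma integral_functional_in_dual:
  "(\<lambda>u\<in>carr (L1_sp \<nu>). \<integral>x. L1_rep u x \<partial>\<nu>) \<in> dual_carr (L1_sp \<nu>)"
proof -
  let ?V = "L1_sp \<nu>" and ?l = "\<lambda>u\<in>carr (L1_sp \<nu>). \<integral>x. L1_rep u x \<partial>\<nu>"
  have in_carr: "L1_class \<nu> \<phi> \<in> carr ?V" if "integrable \<nu> \<phi>" for \<phi>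
    using that by (simp add: L1_sp_def)
  have l: "?l (L1_class \<nu> \<phi>) = (\<integral>x. \<phi> x \<partial>\<nu>)" if "integrable \<nu> \<phi>" for \<phi>
  proof -
    have "(\<integral>x. L1_rep (L1_class \<nu> \<phi>) x \<partial>\<nu>) = (\<integral>x. \<phi> x \<partial>\<nu>)"
      using that L1_rep_class[OF that] by (intro integral_cong_AE) auto
    then show ?thesis using in_carr[OF that] by simp
  qed
  have repr: "\<exists>\<phi>. integrable \<nu> \<phi> \<and> u = L1_class \<nu> \<phi>" if "u \<in> carr ?V" for u
    using that by (auto simp: L1_sp_def)
  have "?l (add_sp ?V u v) = ?l u + ?l v" if "u \<in> carr ?V" "v \<in> carr ?V" for u v
  proof -
    obtain \<phi> \<psi> where "integrable \<nu> \<phi>" "u = L1_class \<nu> \<phi>" "integrable \<nu> \<psi>" "v = L1_class \<nu> \<psi>"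
      using repr \<open>u \<in> carr ?V\<close> \<open>v \<in> carr ?V\<close> by metis
    then show ?thesis by (simp only: L1_add l Bochner_Integration.integrable_add Bochner_Integration.integral_add)
  qed
  moreover have "?l (scale_sp ?V c u) = c * ?l u" if u: "u \<in> carr ?V" for c u
  proof -
    obtain \<phi> where "integrable \<nu> \<phi>" "u = L1_class \<nu> \<phi>"
      using repr u by metis
    then show ?thesis by (simp only: L1_scale l integrable_mult_right integral_mult_right_zero)
  qed
  moreover have "\<bar>?l u\<bar> \<le> 1 * norm_sp ?V u" if u: "u \<in> carr ?V" for u
  proof -
    obtain \<phi> where "integrable \<nu> \<phi>" "u = L1_class \<nu> \<phi>"
      using repr u by metis
    then show ?thesis by (simp only: L1_norm l mult_1_left integral_abs_bound)
  qed
  ultimately show ?thesis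
    unfolding dual_carr_def bounded_functional_def by blast
qed

theorem theorem3p4:
  fixes p :: "'e::metric_space measure"
    and f :: "(nat \<Rightarrow> 'e) \<Rightarrow> real"
    and \<nu> :: "(nat \<Rightarrow> 'e) measure"
    and LL :: "((nat \<Rightarrow> 'e) \<Rightarrow> real) set \<Rightarrow> ((nat \<Rightarrow> 'e) \<Rightarrow> real) set"
  assumes "compact (UNIV :: 'e set)"
    and "prob_space p" and "sets p = sets borel" and "measure_supp p = UNIV"
    and "continuous_on UNIV f"
    and "\<nu> \<in> eigenmeasures p f"
    and "L1_extension p f \<nu> LL"
  shows "\<exists>\<xi> \<in> carr (dual_sp (dual_sp (L1_sp \<nu>))).
    \<xi> \<noteq> zero_sp (dual_sp (dual_sp (L1_sp \<nu>))) \<and>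
    \<xi> \<in> pos_sp (dual_sp (dual_sp (L1_sp \<nu>))) \<and>
    transpose_op (dual_sp (L1_sp \<nu>)) (transpose_op (L1_sp \<nu>) LL) \<xi> =
      scale_sp (dual_sp (dual_sp (L1_sp \<nu>))) (spectral_rad (ruelle p f)) \<xi>"
proof -
  let ?R = "ruelle p f" and ?\<rho> = "spectral_rad (ruelle p f)" and ?V = "L1_sp \<nu>"
  interpret p: prob_space p by fact
  interpret prob_space \<nu> using assms(6) by (simp add: eigenmeasures_def)
  have sets: "sets \<nu> = sets borel" and eigen: "\<And>\<phi>. (\<integral>x. ?R \<phi> x \<partial>\<nu>) = ?\<rho> * (\<integral>x. \<phi> x \<partial>\<nu>)"
    using assms(6) by (auto simp: eigenmeasures_def)
  have int: "integrable \<nu> (apply_bcontfun \<phi>)" for \<phi> :: "(nat \<Rightarrow> 'e) \<Rightarrow>\<^sub>C real"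
  proof (rule integrable_const_bound[of _ "norm \<phi>"])
    show "apply_bcontfun \<phi> \<in> borel_measurable \<nu>"
      using borel_measurable_continuous_onI[OF continuous_on_apply_bcontfun]
        measurable_cong_sets[OF sets refl] by blast
  qed (simp add: norm_bounded[of \<phi>, unfolded real_norm_def])
  note R_apply = ruelle_apply[OF assms(1-3,5)]
  define one :: "(nat \<Rightarrow> 'e) \<Rightarrow>\<^sub>C real" where "one = const_bcontfun 1"
  have one: "apply_bcontfun one x = 1" for x
    by (simp add: one_def const_bcontfun.rep_eq)
  \<comment> \<open>Positivity comes from the eigenmeasure: integrating \<open>?R one\<close>, which
    is positive everywhere, yields exactly \<open>?\<rho>\<close>.\<close>
  have "0 < ?\<rho>"
  proof -
    have "0 < ?R one x" for x
    proof -
      have int: "integrable p (\<lambda>a. exp (f (case_nat a x)))"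
        by (rule ruelle_integrand(1)[OF assms(1-3)]) (intro continuous_intros assms(5))
      \<comment> \<open>A vanishing integral would force the exponential to be zero almost
        everywhere, impossible for a probability measure.\<close>
      have "(\<integral>a. exp (f (case_nat a x)) \<partial>p) \<noteq> 0"
        using integral_nonneg_eq_0_iff_AE[OF int] by (simp add: p.AE_False)
      moreover have "0 \<le> (\<integral>a. exp (f (case_nat a x)) \<partial>p)" by simp
      ultimately show ?thesis
        unfolding R_apply one mult_1_right by linarith
    qed
    then have "(\<integral>x. ?R one x \<partial>\<nu>) \<noteq> 0" and "0 \<le> (\<integral>x. ?R one x \<partial>\<nu>)"
      using integral_nonneg_eq_0_iff_AE[OF int, of "?R one"]
      by (auto simp: less_imp_le AE_False order_less_imp_not_eq2 intro!: integral_nonneg_AE)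
    moreover have "(\<integral>x. ?R one x \<partial>\<nu>) = ?\<rho>" by (simp add: eigen one prob_space)
    ultimately show ?thesis by linarith
  qed
  \<comment> \<open>Dividing by \<open>?\<rho>\<close> at each step cancels the factor from the
    eigenmeasure equation, so the integral stays 1.\<close>
  define g where "g n = ((\<lambda>\<phi>. inverse ?\<rho> *\<^sub>R ?R \<phi>) ^^ n) one" for n
  have g_nonneg: "0 \<le> g n x" for n x
  proof (induction n arbitrary: x)
    case (Suc n)
    then show ?case using \<open>0 < ?\<rho>\<close> by (simp add: g_def R_apply)
  qed (simp add: g_def one)
  have g_int: "(\<integral>x. g n x \<partial>\<nu>) = 1" for n
  proof (induction n)
    case (Suc n)
    then show ?case using \<open>0 < ?\<rho>\<close> by (simp add: g_def eigen)
  qed (simp add: g_def one prob_space)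
  have R_g: "?R (g n) = ?\<rho> *\<^sub>R g (Suc n)" for n
    using \<open>0 < ?\<rho>\<close> by (simp add: g_def)
  have T: "bounded_operator ?V LL" "\<And>\<phi>. LL (L1_class \<nu> (apply_bcontfun \<phi>)) = L1_class \<nu> (?R \<phi>)"
    using assms(7) by (auto simp: L1_extension_def)
  have in_carr: "L1_class \<nu> \<phi> \<in> carr ?V" if "integrable \<nu> \<phi>" for \<phi>
    using that by (simp add: L1_sp_def)
  have repr: "\<exists>\<phi>. integrable \<nu> \<phi> \<and> u = L1_class \<nu> \<phi>" if "u \<in> carr ?V" for u
    using that by (auto simp: L1_sp_def)
  show ?thesis
  proof (rule bidual_eigenvector[where w = "\<lambda>n. L1_class \<nu> (g n)"
        and ?l0.0 = "\<lambda>u\<in>carr ?V. \<integral>x. L1_rep u x \<partial>\<nu>"])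
    show "0 \<le> norm_sp ?V v" for v by (simp add: L1_sp_def)
    show "add_sp ?V v w \<in> carr ?V" if "v \<in> carr ?V" "w \<in> carr ?V" for v w
      using repr[OF that(1)] repr[OF that(2)] by (auto simp: L1_add in_carr)
    show "scale_sp ?V c v \<in> carr ?V" if "v \<in> carr ?V" for c v
      using repr[OF that] by (auto simp: L1_scale in_carr)
    show "L1_class \<nu> (g n) \<in> pos_sp ?V" for n
      using int g_nonneg by (auto simp: L1_sp_def)
    \<comment> \<open>Since \<open>g n\<close> is nonnegative, its norm is its integral, which is
      1.\<close>
    show "norm_sp ?V (L1_class \<nu> (g n)) \<le> 1" for n
      by (simp add: L1_norm int g_nonneg g_int)
    show "LL (L1_class \<nu> (g n)) = scale_sp ?V ?\<rho> (L1_class \<nu> (g (Suc n)))" for n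
      by (simp add: T R_g L1_scale int)
    \<comment> \<open>\<open>L1_rep\<close> chooses an arbitrary member of the class, which agrees
      with \<open>g n\<close> almost everywhere.\<close>
    have "(\<integral>x. L1_rep (L1_class \<nu> (g n)) x \<partial>\<nu>) = (\<integral>x. g n x \<partial>\<nu>)" for n
      using int[of "g n"] L1_rep_class[OF int, of "g n"] by (intro integral_cong_AE) auto
    then show "(\<lambda>u\<in>carr ?V. \<integral>x. L1_rep u x \<partial>\<nu>) (L1_class \<nu> (g n)) = 1" for n
      by (simp add: in_carr int g_int)
  qed (use T int in_carr integral_functional_in_dual in auto)
qed

end
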